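(* Let $K,N\ge 1$ be integers and let $u(i,j)\in\mathbb{N}=\{0,1,2,\dots\}$ for $i\ge 1$, $1\le j\le K$. Queue tandem: define $D(n,j)$ for $n\ge 0$, $0\le j\le K$ by $D(0,j)=0$, $D(n,0)=0$ and $D(n,j)=\max(D(n-1,j),D(n,j-1))+u(n,j)$ for $n,j\ge1$, and set $D=D(N,K)$ (the instant of departure of customer $N$ from queue $K$ in a tandem of $K$ FIFO single-server queues, initially empty except for infinitely many customers $1,2,\dots$ waiting at queue $1$ at time $0$, where $u(i,j)$ is the service time of customer $i$ at queue $j$). Store tandem: for store $1$ set $R_1(n)=u(n,K)$ for $n\ge1$, $R_1(0)=0$. For stores $k=2,\dots,K$ set $L_k(0)=0$, $R_k(0)=0$ and for $n\ge 1$: supply $S_k(n)=R_{k-1}(n-1)$, departure $R_k(n)=\min\big(L_k(n-1)+S_k(n),\,u(n,K+1-k)\big)$, stock $L_k(n)=L_k(n-1)+S_k(n)-R_k(n)$. Set $R=\sum_{n=1}^N R_K(n)$ (cumulative departures from store $K$ over time slots $1$ to $N$; here $u(i,K+1-k)$ is the request at slot $i$ in store $k$). Let $w(U)$ be the word $w_1w_2\cdots w_N$ over the alphabet $\{1,\dots,K\}$ where $w_i=1^{u(i,1)}2^{u(i,2)}\cdots K^{u(i,K)}$ (letter $j$ repeated $u(i,j)$ times), let $P$ be the tableau obtained by RSK row-insertion of the letters of $w(U)$ one by one from left to right into the empty tableau, and let $(\lambda_1,\dots,\lambda_K)$ be its shape. Let $\Pi$ be the set of lattice paths from $(1,1)$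 to $(N,K)$ with steps $(1,0)$ or $(0,1)$, and let $\widetilde\Pi$ be the set of lattice paths starting at a point of $\{(1+i,K-i):0\le i\le K-1\}$, ending at a point of $\{(N-j,1+j):0\le j\le N-1\}$, all of whose steps are of the form $(1+i,-i)$ with $i\ge0$. Then $$\lambda_1=\max_{\pi\in\Pi}\sum_{(i,j)\in\pi}u(i,j)=D,\qquad \lambda_K=\min_{\pi\in\widetilde\Pi}\sum_{(i,j)\in\pi}u(i,j)=R.$$
   Context: RSK row insertion $T\leftarrow i$ of a letter $i$ into a semi-standard Young tableau $T$ (rows weakly increasing left to right, columns strictly increasing top to bottom): if $i$ is at least every entry of the first row, append a box labelled $i$ at the end of the first row; otherwise replace the leftmost entry of the first row strictly larger than $i$ by $i$ and insert the bumped entry into the second row by the same rule, and so on (an empty row accepts any letter). The shape is the sequence of row lengths $\lambda_1\ge\lambda_2\ge\cdots\ge\lambda_K\ge0$ (padded with zeros). When $N<K$, $\widetilde\Pi$ is empty and the minimum over it is taken to be $0$. *)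

theory Defs
  imports Main
begin

fun row_insert :: "nat \<Rightarrow> nat list \<Rightarrow> nat list \<times> nat option" where
  "row_insert i [] = ([i], None)"
| "row_insert i (x # xs) =
     (if i < x then (i # xs, Some x)
      else (case row_insert i xs of (ys, b) \<Rightarrow> (x # ys, b)))"

text \<open>A tableau is the list of its rows, top row first.\<close>

fun tableau_insert :: "nat list list \<Rightarrow> nat \<Rightarrow> nat list list" where
  "tableau_insert [] i = [[i]]"
| "tableau_insert (r # rs) i =
     (case row_insert i r of
        (r', None) \<Rightarrow> r' # rs
      | (r', Some b) \<Rightarrow> r' # tableau_insert rs b)"

definition rsk_tableau :: "nat list \<Rightarrow> nat list list" where
  "rsk_tableau w = foldl tableau_insert [] w"

text \<open>The length of the \<open>k\<close>-th row, rows being numbered from 1; missing rows have length 0.\<close>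

definition shape :: "nat list list \<Rightarrow> nat \<Rightarrow> nat" where
  "shape T k = (if 1 \<le> k \<and> k \<le> length T then length (T ! (k - 1)) else 0)"

definition customer_word :: "nat \<Rightarrow> (nat \<Rightarrow> nat \<Rightarrow> nat) \<Rightarrow> nat \<Rightarrow> nat list" where
  "customer_word K u i = concat (map (\<lambda>j. replicate (u i j) j) [1..<K+1])"

definition matrix_word :: "nat \<Rightarrow> nat \<Rightarrow> (nat \<Rightarrow> nat \<Rightarrow> nat) \<Rightarrow> nat list" where
  "matrix_word N K u = concat (map (customer_word K u) [1..<N+1])"

fun queue_departure :: "(nat \<Rightarrow> nat \<Rightarrow> nat) \<Rightarrow> nat \<Rightarrow> nat \<Rightarrow> nat" where
  "queue_departure u 0 j = 0"
| "queue_departure u (Suc n) 0 = 0"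
| "queue_departure u (Suc n) (Suc j) =
     max (queue_departure u n (Suc j)) (queue_departure u (Suc n) j) + u (Suc n) (Suc j)"

text \<open>
  Stores are numbered from 1; the equations for store 0, and the stock of store 1, are dummies.
  The supply of store \<open>k \<ge> 2\<close> in slot \<open>Suc n\<close> is \<open>store_departure K u (k - 1) n\<close>.
  The subtraction in \<open>store_stock\<close> does not truncate, because the departure is bounded
  by old stock plus supply.
\<close>

function store_departure :: "nat \<Rightarrow> (nat \<Rightarrow> nat \<Rightarrow> nat) \<Rightarrow> nat \<Rightarrow> nat \<Rightarrow> nat"
  and store_stock :: "nat \<Rightarrow> (nat \<Rightarrow> nat \<Rightarrow> nat) \<Rightarrow> nat \<Rightarrow> nat \<Rightarrow> nat" where
  "store_departure K u k 0 = 0"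
| "store_departure K u 0 (Suc n) = 0"
| "store_departure K u (Suc 0) (Suc n) = u (Suc n) K"
| "store_departure K u (Suc (Suc k)) (Suc n) =
     min (store_stock K u (Suc (Suc k)) n + store_departure K u (Suc k) n)
         (u (Suc n) (K + 1 - Suc (Suc k)))"
| "store_stock K u k 0 = 0"
| "store_stock K u 0 (Suc n) = 0"
| "store_stock K u (Suc 0) (Suc n) = 0"
| "store_stock K u (Suc (Suc k)) (Suc n) =
     store_stock K u (Suc (Suc k)) n + store_departure K u (Suc k) n
       - store_departure K u (Suc (Suc k)) (Suc n)"
  by pat_completeness auto
termination
  by (relation "measure (\<lambda>x. case x of
        Inl (K, u, k, n) \<Rightarrow> 2 * n
      | Inr (K, u, k, n) \<Rightarrow> 2 * n + 1)") auto

text \<open>A path is the nonempty list of the points it visits, endpoints included.\<close>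

definition paths ::
  "(nat \<times> nat \<Rightarrow> nat \<times> nat \<Rightarrow> bool) \<Rightarrow> (nat \<times> nat) set \<Rightarrow> (nat \<times> nat) set
     \<Rightarrow> (nat \<times> nat) list set" where
  "paths step A B = {p. p \<noteq> [] \<and> hd p \<in> A \<and> last p \<in> B \<and> successively step p}"

definition up_right_step :: "nat \<times> nat \<Rightarrow> nat \<times> nat \<Rightarrow> bool" where
  "up_right_step p q \<longleftrightarrow> q = (fst p + 1, snd p) \<or> q = (fst p, snd p + 1)"

text \<open>The step \<open>(1 + i, - i)\<close>, with the second coordinate stated additively to stay in \<open>nat\<close>.\<close>

definition down_right_step :: "nat \<times> nat \<Rightarrow> nat \<times> nat \<Rightarrow> bool" where
  "down_right_step p q \<longleftrightarrow> (\<exists>i. fst q = fst p + (1 + i) \<and> snd q + i = snd p)"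

definition Pi_paths :: "nat \<Rightarrow> nat \<Rightarrow> (nat \<times> nat) list set" where
  "Pi_paths N K = paths up_right_step {(1, 1)} {(N, K)}"

text \<open>
  The steps keep such a path inside \<open>{1..N} \<times> {1..K}\<close>: the first coordinate increases up to
  \<open>N - j\<close> and the second one decreases from \<open>K - i\<close> to \<open>1 + j\<close>.
\<close>

definition Pi_tilde_paths :: "nat \<Rightarrow> nat \<Rightarrow> (nat \<times> nat) list set" where
  "Pi_tilde_paths N K =
     paths down_right_step {(1 + i, K - i) |i. i \<le> K - 1} {(N - j, 1 + j) |j. j \<le> N - 1}"

definition path_weight :: "(nat \<Rightarrow> nat \<Rightarrow> nat) \<Rightarrow> (nat \<times> nat) list \<Rightarrow> nat" where
  "path_weight u p = (\<Sum>(i, j)\<leftarrow>p. u i j)"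

definition max_path_weight :: "nat \<Rightarrow> nat \<Rightarrow> (nat \<Rightarrow> nat \<Rightarrow> nat) \<Rightarrow> nat" where
  "max_path_weight N K u = Max (path_weight u ` Pi_paths N K)"

definition min_path_weight :: "nat \<Rightarrow> nat \<Rightarrow> (nat \<Rightarrow> nat \<Rightarrow> nat) \<Rightarrow> nat" where
  "min_path_weight N K u =
     (if Pi_tilde_paths N K = {} then 0 else Min (path_weight u ` Pi_tilde_paths N K))"

end

(*
  Counting the letters at most j in the first row turns row insertion of a customer word into
  the queue recursion, whose value is a maximal path weight.

  For the last row, let a letter j < K act on a sequence A by A_j := min (A_j + 1) A_(j+1), and
  the letter K by A_K := A_K + 1. On weakly increasing sequences this respects the Knuth
  relations, so a word and the row reading word of its tableau act alike. Started from zero, the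
  reading word ends with A_1 = lambda_K, the number of columns of length K, while the matrix
  word computes the cumulative store departures, and these satisfy the recursion of the minimal
  path weight.
*)

theory Submission
  imports Defs
begin

section \<open>Row insertion\<close>

definition le_count :: "nat \<Rightarrow> nat list \<Rightarrow> nat" where
  "le_count j r = length (filter (\<lambda>x. x \<le> j) r)"

lemma le_count_Nil [simp]: "le_count j [] = 0"
  and le_count_Cons [simp]: "le_count j (x # r) = (if x \<le> j then 1 else 0) + le_count j r"
  by (simp_all add: le_count_def)

lemma le_count_mono: "j \<le> k \<Longrightarrow> le_count j r \<le> le_count k r"
  by (induction r) auto

lemma le_count_eq_0: "(\<And>x. x \<in> set r \<Longrightarrow> j < x) \<Longrightarrow> le_count j r = 0"
  by (induction r) (auto simp: not_le)

lemma le_count_eq_0_D: "le_count j r = 0 \<Longrightarrow> x \<in> set r \<Longrightarrow> j < x"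
  by (induction r) (auto split: if_splits)

lemma le_count_eq_length: "(\<And>x. x \<in> set r \<Longrightarrow> x \<le> j) \<Longrightarrow> le_count j r = length r"
  by (simp add: le_count_def)

text \<open>The letter lands directly behind the entries \<open>\<le> i\<close>, at position
  \<open>Suc (le_count i r)\<close>. For \<open>l \<ge> i\<close> the count rises only if that
  position held no entry \<open>\<le> l\<close> before; the maximum covers both cases.\<close>

lemma le_count_row_insert:
  assumes "sorted r"
  shows "le_count l (fst (row_insert i r)) =
    (if l < i then le_count l r else max (le_count l r) (Suc (le_count i r)))"
  using assms
proof (induction r)
  case (Cons x r)
  show ?case
  proof (cases "i < x")
    case True
    have "le_count i r = 0"
      using True Cons.prems by (intro le_count_eq_0) auto
    moreover have "\<not> x \<le> l \<Longrightarrow> le_count l r = 0"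
      using Cons.prems by (intro le_count_eq_0) auto
    ultimately show ?thesis
      using True by auto
  next
    case False
    then show ?thesis
      using Cons by (auto split: prod.splits)
  qed
qed auto

lemma row_insert_None:
  "row_insert i r = (r', None) \<Longrightarrow> r' = r @ [i] \<and> (\<forall>x\<in>set r. x \<le> i)"
  by (induction r arbitrary: r') (auto split: if_splits prod.splits)

lemma row_insert_Some:
  "row_insert i r = (r', Some b) \<Longrightarrow>
    \<exists>p s. r = p @ b # s \<and> r' = p @ i # s \<and> (\<forall>x\<in>set p. x \<le> i) \<and> i < b"
proof (induction r arbitrary: r')
  case (Cons x r)
  show ?case
  proof (cases "i < x")
    case True
    then show ?thesis
      using Cons.prems by (intro exI[of _ "[]"] exI[of _ r]) auto
  next
    case False
    obtain ys where ys: "row_insert i r = (ys, Some b)" "r' = x # ys"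
      using Cons.prems False by (auto split: prod.splits)
    obtain p s where "r = p @ b # s" "ys = p @ i # s" "\<forall>x\<in>set p. x \<le> i" "i < b"
      using Cons.IH[OF ys(1)] by blast
    then show ?thesis
      using ys False by (intro exI[of _ "x # p"] exI[of _ s]) auto
  qed
qed auto

lemma sorted_row_insert: "sorted r \<Longrightarrow> sorted (fst (row_insert i r))"
proof (cases "row_insert i r")
  case (Pair r' b)
  assume "sorted r"
  then show ?thesis
    using Pair row_insert_None[of i r r'] row_insert_Some[of i r r']
    by (cases b) (fastforce simp: sorted_append)+
qed

section \<open>The tableau property\<close>

text \<open>For sorted rows this says that \<open>s\<close> fits below \<open>r\<close> with strictly increasing columns.\<close>

definition interlaced :: "nat list \<Rightarrow> nat list \<Rightarrow> bool" where
  "interlaced r s \<longleftrightarrow> (\<forall>j. le_count (Suc j) s \<le> le_count j r) \<and> le_count 0 s = 0"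

definition first_row :: "nat list list \<Rightarrow> nat list" where
  "first_row T = (case T of [] \<Rightarrow> [] | r # _ \<Rightarrow> r)"

lemma first_row_simps [simp]: "first_row [] = []" "first_row (r # T) = r"
  by (simp_all add: first_row_def)

lemma first_row_insert: "first_row (tableau_insert T i) = fst (row_insert i (first_row T))"
  by (cases T) (auto split: prod.splits option.splits)

text \<open>The alphabet \<open>X\<close> is a parameter: the plactic argument runs over
  \<open>UNIV\<close>, while reading off row lengths uses the bounds \<open>{..K}\<close> and
  \<open>{1..K}\<close>.\<close>

fun tableau :: "nat set \<Rightarrow> nat list list \<Rightarrow> bool" where
  "tableau X [] \<longleftrightarrow> True"
| "tableau X (r # T) \<longleftrightarrow>
    sorted r \<and> set r \<subseteq> X \<and> interlaced r (first_row T) \<and> tableau X T"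

lemma tableau_first_row: "tableau X T \<Longrightarrow> sorted (first_row T) \<and> set (first_row T) \<subseteq> X"
  by (cases T) auto

text \<open>No entry of \<open>r\<close> lies strictly between \<open>i\<close> and the bumped
  \<open>b\<close>, so interlacing at \<open>b - 1\<close> gives
  \<open>le_count b s \<le> le_count i r\<close>. Hence \<open>b\<close> lands in \<open>s\<close>
  no further right than the place it left in \<open>r\<close>.\<close>

lemma interlaced_row_insert:
  assumes "sorted r" "sorted s" "interlaced r s" "row_insert i r = (r', Some b)"
  shows "interlaced r' (fst (row_insert b s))"
proof -
  obtain p q where r: "r = p @ b # q" and p: "\<forall>x\<in>set p. x \<le> i" and "i < b"
    using row_insert_Some[OF assms(4)] by blast
  have "\<forall>x\<in>set (b # q). b \<le> x"
    using assms(1) r by (auto simp: sorted_append)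
  then have "filter (\<lambda>x. x \<le> b - 1) r = filter (\<lambda>x. x \<le> i) r"
    using \<open>i < b\<close> p unfolding r by (fastforce intro!: filter_cong)
  then have eq: "le_count (b - 1) r = le_count i r"
    by (simp add: le_count_def)
  have r': "le_count l r' = (if l < i then le_count l r else max (le_count l r) (Suc (le_count i r)))"
    for l
    using le_count_row_insert[OF assms(1), of l i] assms(4) by simp
  have below: "le_count (Suc j) s \<le> le_count j r" for j
    using assms(3) by (auto simp: interlaced_def)
  have "le_count b s \<le> le_count i r"
    using below[of "b - 1"] eq \<open>i < b\<close> by simp
  then have "le_count (Suc j) (fst (row_insert b s)) \<le> le_count j r'" for j
    using below[of j] \<open>i < b\<close> unfolding le_count_row_insert[OF assms(2)] r' by auto
  moreover have "le_count 0 (fst (row_insert b s)) = 0"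
    using assms(3) \<open>i < b\<close> unfolding le_count_row_insert[OF assms(2)] by (simp add: interlaced_def)
  ultimately show ?thesis
    by (simp add: interlaced_def)
qed

lemma tableau_insert_tableau:
  "tableau X T \<Longrightarrow> i \<in> X \<Longrightarrow> tableau X (tableau_insert T i)"
proof (induction T arbitrary: i)
  case Nil
  then show ?case by (simp add: interlaced_def)
next
  case (Cons r T)
  obtain r' b where ins: "row_insert i r = (r', b)"
    by fastforce
  have r: "sorted r" "set r \<subseteq> X" "interlaced r (first_row T)" "tableau X T"
    using Cons.prems by auto
  have "sorted r'"
    using sorted_row_insert[OF r(1), of i] ins by simp
  show ?case
  proof (cases b)
    case None
    have "le_count l r \<le> le_count l r'" for l
      using le_count_row_insert[OF r(1), of l i] ins by auto
    then have "interlaced r' (first_row T)"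
      using r(3) order_trans unfolding interlaced_def by blast
    moreover have "set r' \<subseteq> X"
      using row_insert_None[of i r r'] ins None r(2) Cons.prems(2) by auto
    ultimately show ?thesis
      using \<open>sorted r'\<close> r(4) ins None by simp
  next
    case (Some c)
    obtain p s where ps: "r = p @ c # s" "r' = p @ i # s"
      using row_insert_Some[of i r r' c] ins Some by auto
    have "interlaced r' (first_row (tableau_insert T c))"
      using interlaced_row_insert[OF r(1) _ r(3)] tableau_first_row[OF r(4)] ins Some
      by (simp add: first_row_insert)
    moreover have "tableau X (tableau_insert T c)"
      using Cons.IH[OF r(4)] ps r(2) by auto
    ultimately show ?thesis
      using \<open>sorted r'\<close> ps r(2) Cons.prems(2) ins Some by auto
  qed
qed

lemma tableau_foldl:
  "tableau X T \<Longrightarrow> set w \<subseteq> X \<Longrightarrow> tableau X (foldl tableau_insert T w)"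
  by (induction w arbitrary: T) (auto simp: tableau_insert_tableau)

lemma tableau_rsk: "set w \<subseteq> X \<Longrightarrow> tableau X (rsk_tableau w)"
  by (simp add: rsk_tableau_def tableau_foldl)

text \<open>Strict columns raise a lower bound on the letters by one per row: a count of zero below
  \<open>k\<close> in \<open>r\<close> forces a count of zero up to \<open>k\<close> in
  \<open>s\<close>.\<close>

lemma interlaced_letters:
  assumes "interlaced r s" "\<And>x. x \<in> set r \<Longrightarrow> k \<le> x" "y \<in> set s"
  shows "Suc k \<le> y"
proof -
  have "le_count k s = 0"
  proof (cases k)
    case 0
    then show ?thesis using assms(1) by (simp add: interlaced_def)
  next
    case (Suc m)
    have "le_count m r = 0"
      using assms(2) Suc by (intro le_count_eq_0) (simp add: Suc_le_eq)
    then show ?thesis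
      using assms(1) Suc by (metis interlaced_def le_zero_eq)
  qed
  then show ?thesis
    using assms(3) le_count_eq_0_D by (simp add: Suc_le_eq)
qed

lemma tableau_letters_ge:
  assumes "tableau X T" "\<And>x. x \<in> set (first_row T) \<Longrightarrow> k \<le> x" "x \<in> set (concat T)"
  shows "k \<le> x"
  using assms
proof (induction T arbitrary: k)
  case (Cons r T)
  have "Suc k \<le> y" if "y \<in> set (first_row T)" for y
    using interlaced_letters[of r "first_row T" k y] Cons.prems(1,2) that by simp
  then have "x \<in> set (concat T) \<Longrightarrow> Suc k \<le> x"
    using Cons.IH[of "Suc k"] Cons.prems(1) by simp
  then show ?case
    using Cons.prems(2,3) by fastforce
qed simp

section \<open>A plactic action\<close>

text \<open>
  The state \<open>A\<close> records for each letter \<open>j\<close> how many disjoint copies of the subsequence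
  \<open>K, K - 1, \<dots>, j\<close> a greedy reader has found; this is the cumulative departure of
  store \<open>K + 1 - j\<close>.
\<close>

definition store_step :: "nat \<Rightarrow> (nat \<Rightarrow> nat) \<Rightarrow> nat \<Rightarrow> (nat \<Rightarrow> nat)" where
  "store_step K A j = A(j := if j < K then min (Suc (A j)) (A (Suc j)) else Suc (A j))"

definition chain :: "nat \<Rightarrow> (nat \<Rightarrow> nat) \<Rightarrow> bool" where
  "chain K A \<longleftrightarrow> (\<forall>j<K. A j \<le> A (Suc j))"

lemma chain_step: "chain K A \<Longrightarrow> chain K (store_step K A j)"
  unfolding chain_def store_step_def by (auto simp: le_Suc_eq min_def) (meson Suc_lessD le_trans)

lemma chain_foldl: "chain K A \<Longrightarrow> chain K (foldl (store_step K) A w)"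
  by (induction w arbitrary: A) (auto simp: chain_step)

text \<open>A letter changes its own entry and reads at most the next one. So \<open>x < z\<close>
  can interfere only if \<open>x\<close> reads the entry of \<open>z\<close>, which means
  \<open>z = Suc x\<close> and \<open>x < K\<close>.\<close>

lemma store_step_commute:
  "x < z \<Longrightarrow> z \<noteq> Suc x \<or> x \<ge> K \<Longrightarrow>
    store_step K (store_step K A x) z = store_step K (store_step K A z) x"
  by (auto simp: store_step_def fun_eq_iff)

text \<open>The Knuth relation \<open>x z y ~ z x y\<close>. Where \<open>x\<close> and
  \<open>z\<close> do not commute, \<open>z = Suc x\<close> forces \<open>y = x\<close>, and the
  remaining identity between minima uses \<open>A x \<le> A z\<close>.\<close>

lemma knuth1:
  assumes "chain K A" "x \<le> y" "y < z"
  shows "store_step K (store_step K (store_step K A x) z) y =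
    store_step K (store_step K (store_step K A z) x) y"
proof (cases "z \<noteq> Suc x \<or> x \<ge> K")
  case True
  then show ?thesis using store_step_commute[of x z K A] assms by simp
next
  case False
  then have "y = x" "z = Suc x" "x < K" "A x \<le> A z"
    using assms by (auto simp: chain_def)
  then show ?thesis
    by (auto simp: store_step_def fun_eq_iff min_def)
qed

text \<open>The Knuth relation \<open>y z x ~ y x z\<close>. In the only case without commutation,
  \<open>y = z = Suc x\<close>.\<close>

lemma knuth2:
  assumes "chain K A" "x < y" "y \<le> z"
  shows "store_step K (store_step K (store_step K A y) z) x =
    store_step K (store_step K (store_step K A y) x) z"
proof (cases "z \<noteq> Suc x \<or> x \<ge> K")
  case True
  then show ?thesis using store_step_commute[of x z K "store_step K A y"] assms by simp
next
  case False
  then have "y = Suc x" "z = Suc x" "x < K" "A x \<le> A z" "z < K \<longrightarrow> A z \<le> A (Suc z)"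
    using assms by (auto simp: chain_def)
  then show ?thesis
    by (auto simp: store_step_def fun_eq_iff min_def)
qed

text \<open>The new letter \<open>i\<close> travels left through \<open>s\<close> by
  \<open>knuth2\<close>; the letter directly before the exchanged pair serves as the middle letter
  \<open>y\<close>.\<close>

lemma bump_suffix:
  "chain K A \<Longrightarrow> sorted (y # s) \<Longrightarrow> i < y \<Longrightarrow>
    foldl (store_step K) A (y # s @ [i]) = foldl (store_step K) A (y # i # s)"
proof (induction s arbitrary: A y)
  case (Cons z t)
  have "foldl (store_step K) (store_step K A y) (z # t @ [i]) =
      foldl (store_step K) (store_step K A y) (z # i # t)"
    using Cons.prems by (intro Cons.IH chain_step) auto
  then show ?case
    using knuth2[of K A i y z] Cons.prems by simp
qed auto

text \<open>Now \<open>b\<close> travels left through \<open>p\<close> by \<open>knuth1\<close>; the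
  middle letter is the one directly behind the exchanged pair.\<close>

lemma bump_prefix:
  "chain K A \<Longrightarrow> sorted p \<Longrightarrow> \<forall>x\<in>set p. x \<le> i \<Longrightarrow> i < b \<Longrightarrow>
    foldl (store_step K) A (p @ [b, i]) = foldl (store_step K) A (b # p @ [i])"
proof (induction p arbitrary: A)
  case (Cons x q)
  have IH: "foldl (store_step K) (store_step K A x) (q @ [b, i]) =
      foldl (store_step K) (store_step K A x) (b # q @ [i])"
    using Cons.prems by (intro Cons.IH chain_step) auto
  \<comment> \<open>The letter after \<open>x\<close> is the next one of \<open>p\<close>, or
    \<open>i\<close> itself when \<open>p\<close> is exhausted.\<close>
  obtain y t where yt: "q @ [i] = y # t"
    by (cases q) auto
  have "y \<in> set (q @ [i])"
    unfolding yt by simp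
  then have "x \<le> y" "y < b"
    using Cons.prems by auto
  then have "foldl (store_step K) A (x # b # y # t) = foldl (store_step K) A (b # x # y # t)"
    using knuth1[of K A x y b] Cons.prems by simp
  then show ?case
    using IH yt by simp
qed auto

text \<open>With \<open>r = p b s\<close>, the word \<open>p b s i\<close> becomes
  \<open>p b i s\<close> and then \<open>b p i s\<close>, which is the bumped letter followed by the
  new row.\<close>

lemma store_step_row_insert:
  assumes "chain K A" "sorted r" "row_insert i r = (r', Some b)"
  shows "foldl (store_step K) A (r @ [i]) = foldl (store_step K) A (b # r')"
proof -
  obtain p s where ps: "r = p @ b # s" "r' = p @ i # s" "\<forall>x\<in>set p. x \<le> i" "i < b"
    using row_insert_Some[OF assms(3)] by blast
  have "foldl (store_step K) A (r @ [i]) =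
      foldl (store_step K) (foldl (store_step K) A p) (b # s @ [i])"
    by (simp add: ps)
  also have "\<dots> = foldl (store_step K) (foldl (store_step K) A p) (b # i # s)"
    using assms ps by (intro bump_suffix chain_foldl) (auto simp: sorted_append)
  also have "\<dots> = foldl (store_step K) (foldl (store_step K) A (p @ [b, i])) s"
    by simp
  also have "foldl (store_step K) A (p @ [b, i]) = foldl (store_step K) A (b # p @ [i])"
    using assms ps by (intro bump_prefix) (auto simp: sorted_append)
  finally show ?thesis
    by (simp add: ps)
qed

abbreviation row_word :: "nat list list \<Rightarrow> nat list" where
  "row_word T \<equiv> concat (rev T)"

text \<open>Rows are read from bottom to top, so a bumped letter in front of its row stands directly
  behind the rows into which it is inserted next.\<close>

lemma store_step_tableau_insert:
  "chain K A \<Longrightarrow> tableau X T \<Longrightarrow>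
    foldl (store_step K) A (row_word (tableau_insert T i)) = foldl (store_step K) A (row_word T @ [i])"
proof (induction T arbitrary: i)
  case (Cons r T)
  obtain r' b where ins: "row_insert i r = (r', b)"
    by fastforce
  show ?case
  proof (cases b)
    case None
    then show ?thesis
      using ins row_insert_None[of i r r'] by simp
  next
    case (Some c)
    have "foldl (store_step K) (foldl (store_step K) A (row_word T)) (r @ [i]) =
        foldl (store_step K) (foldl (store_step K) A (row_word T)) (c # r')"
      using Cons.prems ins Some by (intro store_step_row_insert chain_foldl) auto
    then show ?thesis
      using Cons.IH[of c] Cons.prems ins Some by simp
  qed
qed simp

lemma store_step_rsk:
  assumes "chain K A"
  shows "foldl (store_step K) A (row_word (rsk_tableau w)) = foldl (store_step K) A w"
proof (induction w rule: rev_induct)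
  case (snoc i w)
  have "foldl (store_step K) A (row_word (rsk_tableau (w @ [i]))) =
      foldl (store_step K) A (row_word (rsk_tableau w) @ [i])"
    using store_step_tableau_insert[OF assms tableau_rsk[of w UNIV]] by (simp add: rsk_tableau_def)
  then show ?case
    by (simp add: snoc)
qed (simp add: rsk_tableau_def)

section \<open>Reading the number of full columns off the action\<close>

lemma store_step_other: "j \<notin> set w \<Longrightarrow> foldl (store_step K) A w j = A j"
  by (induction w arbitrary: A) (auto simp: store_step_def)

lemma store_step_replicate:
  "j < K \<Longrightarrow> A j \<le> A (Suc j) \<Longrightarrow>
    foldl (store_step K) A (replicate p j) = A(j := min (A j + p) (A (Suc j)))"
  by (induction p arbitrary: A) (auto simp: store_step_def fun_eq_iff)

lemma store_step_replicate_top: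
  "foldl (store_step K) A (replicate p K) = A(K := A K + p)"
  by (induction p arbitrary: A) (auto simp: store_step_def fun_eq_iff)

lemma sorted_split_least:
  assumes "sorted r" "\<And>x. x \<in> set r \<Longrightarrow> k \<le> x"
  shows "\<exists>s. r = replicate (le_count k r) k @ s \<and> k \<notin> set s"
  using assms
proof (induction r)
  case (Cons x r)
  show ?case
  proof (cases "x = k")
    case True
    then show ?thesis using Cons by auto
  next
    case False
    then have "\<forall>y\<in>set (x # r). k < y"
      using Cons.prems by fastforce
    then have "k \<notin> set (x # r)" "le_count k (x # r) = 0"
      by (auto intro!: le_count_eq_0)
    then show ?thesis by auto
  qed
qed simp

text \<open>
  In row \<open>k\<close> all letters \<open>k\<close> come first, and interlacing makes them at least as many as the
  full columns, so the greedy reader finds exactly one copy per full column.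
\<close>

lemma store_step_row_word:
  assumes "tableau {..K} T" "\<And>x. x \<in> set (first_row T) \<Longrightarrow> k \<le> x" "k \<le> K"
  shows "foldl (store_step K) (\<lambda>_. 0) (row_word T) k = shape T (Suc K - k)
    \<and> shape T (Suc K - k) \<le> le_count k (first_row T)"
  using assms
proof (induction T arbitrary: k)
  case (Cons r T)
  define A where "A = foldl (store_step K) (\<lambda>_. 0) (row_word T)"
  have r: "sorted r" "set r \<subseteq> {..K}" "interlaced r (first_row T)" "tableau {..K} T"
    using Cons.prems by auto
  have below: "Suc k \<le> y" if "y \<in> set (first_row T)" for y
    using interlaced_letters[OF r(3) _ that] Cons.prems(2) by simp
  \<comment> \<open>The lower rows have letters at least \<open>Suc k\<close>, so reading them
    leaves entry \<open>k\<close> at zero; in the first row only the leading block of letters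
    \<open>k\<close> affects it.\<close>
  have "k \<notin> set (row_word T)"
    using tableau_letters_ge[OF r(4) below, of k] by auto
  then have A0: "A k = 0"
    by (simp add: A_def store_step_other)
  define c where "c = le_count k r"
  obtain s where s: "r = replicate c k @ s" "k \<notin> set s"
    using sorted_split_least[OF r(1), of k] Cons.prems(2) unfolding c_def by auto
  have eq: "foldl (store_step K) (\<lambda>_. 0) (row_word (r # T)) k =
      foldl (store_step K) A (replicate c k) k"
    using s by (simp add: A_def store_step_other)
  show ?case
  proof (cases "k = K")
    case True
    have "c = length r"
      unfolding c_def using r(2) True by (intro le_count_eq_length) auto
    then show ?thesis
      unfolding eq using True A0 by (simp add: store_step_replicate_top shape_def c_def)
  next
    case False
    then have "k < K"
      using Cons.prems(3) by simp
    then have IH: "A (Suc k) = shape T (K - k)" "shape T (K - k) \<le> le_count (Suc k) (first_row T)"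
      using Cons.IH[OF r(4) below] by (simp_all add: A_def)
    \<comment> \<open>Reading \<open>c\<close> letters \<open>k\<close> from zero gives
      \<open>min c (A (Suc k))\<close>. Interlacing makes this \<open>A (Suc k)\<close>, the length
      of row \<open>K - k\<close> of \<open>T\<close>, which is one row lower in
      \<open>r # T\<close>.\<close>
    have "le_count (Suc k) (first_row T) \<le> c"
      using r(3) by (simp add: interlaced_def c_def)
    moreover have "shape (r # T) (Suc K - k) = shape T (K - k)"
      using \<open>k < K\<close> by (simp add: shape_def nth_Cons' Suc_diff_le)
    ultimately show ?thesis
      unfolding eq using \<open>k < K\<close> A0 IH by (simp add: store_step_replicate c_def)
  qed
qed (simp add: shape_def)

section \<open>Stores\<close>

text \<open>These are the cumulative departures of store \<open>K + 1 - j\<close>, as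
  \<open>sum_store_departure\<close> confirms. The recursion is also the effect of one customer word
  on the state of \<open>store_step\<close>.\<close>

fun store_total :: "nat \<Rightarrow> (nat \<Rightarrow> nat \<Rightarrow> nat) \<Rightarrow> nat \<Rightarrow> nat \<Rightarrow> nat" where
  "store_total K u 0 j = 0"
| "store_total K u (Suc n) j =
    (if j < K then min (store_total K u n j + u (Suc n) j) (store_total K u n (Suc j))
     else store_total K u n j + u (Suc n) j)"

text \<open>Letters come in increasing order, so entry \<open>Suc j\<close> still has its old value
  while the letters \<open>j\<close> are read. This matches the delay of one slot in the
  supply.\<close>

lemma store_step_customer_prefix:
  assumes "chain K A" "m \<le> K"
  shows "foldl (store_step K) A (concat (map (\<lambda>j. replicate (v j) j) [1..<m+1])) =
    (\<lambda>j. if 1 \<le> j \<and> j \<le> m then (if j < K then min (A j + v j) (A (Suc j)) else A j + v j) else A j)"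
  using assms(2)
proof (induction m)
  case (Suc m)
  \<comment> \<open>The closed form for repeated letters requires the entry not to exceed its
    neighbour initially.\<close>
  have "A (Suc m) \<le> A (Suc (Suc m))" if "Suc m < K"
    using assms(1) that by (simp add: chain_def)
  then show ?case
    using Suc by (auto simp: fun_eq_iff store_step_replicate store_step_replicate_top le_Suc_eq
        dest!: le_imp_less_or_eq)
qed auto

lemma matrix_word_0 [simp]: "matrix_word 0 K u = []"
  and matrix_word_Suc [simp]:
    "matrix_word (Suc n) K u = matrix_word n K u @ customer_word K u (Suc n)"
  by (simp_all add: matrix_word_def)

lemma set_matrix_word: "set (matrix_word n K u) \<subseteq> {1..K}"
  by (auto simp: matrix_word_def customer_word_def)

lemma store_step_matrix_word:
  "1 \<le> j \<Longrightarrow> j \<le> K \<Longrightarrow>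
    foldl (store_step K) (\<lambda>_. 0) (matrix_word n K u) j = store_total K u n j"
proof (induction n arbitrary: j)
  case (Suc n)
  have "chain K (foldl (store_step K) (\<lambda>_. 0) (matrix_word n K u))"
    by (intro chain_foldl) (simp add: chain_def)
  then show ?case
    using store_step_customer_prefix[of K _ K "u (Suc n)"] Suc by (simp add: customer_word_def)
qed simp

text \<open>Conservation of goods: what has been supplied is in stock or has left. The right-hand
  sum stops before \<open>n\<close> because supply arrives one slot after departing
  upstream.\<close>

lemma stock_balance:
  "store_stock K u (Suc (Suc k)) n + (\<Sum>m\<le>n. store_departure K u (Suc (Suc k)) m) =
    (\<Sum>m<n. store_departure K u (Suc k) m)"
  by (induction n) auto

text \<open>By \<open>stock_balance\<close>, old departures plus stock plus supply equal the
  upstream total up to slot \<open>n\<close>. Adding the old departures inside the minimum thus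
  yields the recursion of \<open>store_total\<close>.\<close>

lemma sum_store_departure:
  "k < K \<Longrightarrow> (\<Sum>m\<le>n. store_departure K u (Suc k) m) = store_total K u n (K - k)"
proof (induction n arbitrary: k)
  case (Suc n)
  show ?case
  proof (cases k)
    case 0
    then show ?thesis using Suc by simp
  next
    case (Suc l)
    have "(\<Sum>m\<le>n. store_departure K u (Suc l) m) =
        (\<Sum>m<n. store_departure K u (Suc l) m) + store_departure K u (Suc l) n"
      by (simp flip: lessThan_Suc_atMost)
    then show ?thesis
      using Suc.IH[of k] Suc.IH[of l] Suc.prems stock_balance[of K u l n] Suc
      by (auto simp: Suc_diff_Suc min_def)
  qed
qed simp

lemma shape_last_row:
  assumes "K \<ge> 1"
  shows "shape (rsk_tableau (matrix_word n K u)) K = store_total K u n 1"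
proof -
  let ?w = "matrix_word n K u"
  have w: "tableau {1..K} (rsk_tableau ?w)" "tableau {..K} (rsk_tableau ?w)"
    using set_matrix_word[of n K u] by (auto intro!: tableau_rsk)
  have "1 \<le> x" if "x \<in> set (first_row (rsk_tableau ?w))" for x
    using tableau_first_row[OF w(1)] that by auto
  then have "foldl (store_step K) (\<lambda>_. 0) (row_word (rsk_tableau ?w)) 1 = shape (rsk_tableau ?w) K"
    using store_step_row_word[OF w(2), of 1] assms by simp
  moreover have "chain K (\<lambda>_. 0)"
    by (simp add: chain_def)
  ultimately show ?thesis
    using store_step_rsk[of K "\<lambda>_. 0" ?w] store_step_matrix_word[of 1 K n u] assms by simp
qed

section \<open>Queues\<close>

lemma first_row_foldl:
  "first_row (foldl tableau_insert T w) = foldl (\<lambda>r i. fst (row_insert i r)) (first_row T) w"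
  by (induction w arbitrary: T) (simp_all add: first_row_insert)

lemma le_count_replicate:
  "sorted r \<Longrightarrow> sorted (foldl (\<lambda>r i. fst (row_insert i r)) r (replicate p i)) \<and>
    le_count l (foldl (\<lambda>r i. fst (row_insert i r)) r (replicate p i)) =
      (if l < i then le_count l r else max (le_count l r) (le_count i r + p))"
proof (induction p arbitrary: r)
  case 0
  then show ?case using le_count_mono[of i l r] by (auto simp: max_def)
next
  case (Suc p)
  show ?case
    using Suc.IH[OF sorted_row_insert[OF Suc.prems], of i] le_count_row_insert[OF Suc.prems]
    by (simp add: max_def)
qed

text \<open>Midway through a customer word, the counts up to \<open>m\<close> are already the new
  departure times. At \<open>j = Suc m\<close> the count is the instant at which service in queue
  \<open>Suc m\<close> begins.\<close>

lemma le_count_customer_prefix: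
  fixes r u n
  defines "prefix \<equiv> \<lambda>m. foldl (\<lambda>r i. fst (row_insert i r)) r
      (concat (map (\<lambda>j. replicate (u (Suc n) j) j) [1..<m+1]))"
  assumes "sorted r" "\<And>j. j \<le> K \<Longrightarrow> le_count j r = queue_departure u n j" "m \<le> K"
  shows "sorted (prefix m) \<and> (\<forall>j\<le>K. le_count j (prefix m) =
      (if j \<le> m then queue_departure u (Suc n) j
       else max (queue_departure u n j) (queue_departure u (Suc n) m)))"
  using assms(4)
proof (induction m)
  case 0
  have "queue_departure u n 0 = 0"
    by (cases n) auto
  then show ?case using assms(2,3) by (auto simp: prefix_def)
next
  case (Suc m)
  have eq: "prefix (Suc m) =
      foldl (\<lambda>r i. fst (row_insert i r)) (prefix m) (replicate (u (Suc n) (Suc m)) (Suc m))"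
    by (simp add: prefix_def)
  have IH: "sorted (prefix m)" "\<And>j. j \<le> K \<Longrightarrow> le_count j (prefix m) =
      (if j \<le> m then queue_departure u (Suc n) j
       else max (queue_departure u n j) (queue_departure u (Suc n) m))"
    using Suc by simp_all
  have "le_count j (prefix (Suc m)) = (if j \<le> Suc m then queue_departure u (Suc n) j
      else max (queue_departure u n j) (queue_departure u (Suc n) (Suc m)))" if "j \<le> K" for j
    using that Suc.prems le_count_replicate[OF IH(1), of "u (Suc n) (Suc m)" "Suc m" j]
    unfolding eq by (cases j "Suc m" rule: linorder_cases) (simp_all add: IH(2))
  then show ?case
    using le_count_replicate[OF IH(1)] eq by simp
qed

lemma le_count_first_row:
  "sorted (first_row (rsk_tableau (matrix_word n K u))) \<and>
    (\<forall>j\<le>K. le_count j (first_row (rsk_tableau (matrix_word n K u))) = queue_departure u n j)"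
proof (induction n)
  case (Suc n)
  let ?r = "first_row (rsk_tableau (matrix_word n K u))"
  have "first_row (rsk_tableau (matrix_word (Suc n) K u)) =
      foldl (\<lambda>r i. fst (row_insert i r)) ?r (customer_word K u (Suc n))"
    by (simp add: rsk_tableau_def first_row_foldl)
  then show ?case
    using le_count_customer_prefix[of ?r K u n K] Suc by (simp add: customer_word_def)
qed (simp add: rsk_tableau_def)

lemma shape_first_row:
  "shape (rsk_tableau (matrix_word n K u)) 1 = queue_departure u n K"
proof -
  let ?T = "rsk_tableau (matrix_word n K u)"
  have "tableau {1..K} ?T"
    using set_matrix_word by (rule tableau_rsk)
  \<comment> \<open>No letter exceeds \<open>K\<close>, so the count at \<open>K\<close> is the
    whole row length.\<close>
  then have "le_count K (first_row ?T) = length (first_row ?T)"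
    using tableau_first_row by (intro le_count_eq_length) fastforce
  then show ?thesis
    using le_count_first_row[of n K u] by (cases ?T) (simp_all add: shape_def)
qed

section \<open>Paths\<close>

lemma path_weight_snoc [simp]: "path_weight u (p @ [(a, b)]) = path_weight u p + u a b"
  and path_weight_Nil [simp]: "path_weight u [] = 0"
  by (simp_all add: path_weight_def)

text \<open>Both kinds of step raise the coordinate sum by exactly one. This bounds the length and
  the points of a path by its end, whence the path sets are finite.\<close>

lemma successively_bounds:
  assumes "\<And>p q. step p q \<Longrightarrow> fst q + snd q = Suc (fst p + snd p)"
    and "successively step p" "p \<noteq> []"
  shows "fst (last p) + snd (last p) + 1 = fst (hd p) + snd (hd p) + length p
    \<and> (\<forall>x\<in>set p. fst x + snd x \<le> fst (last p) + snd (last p))"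
  using assms(2,3)
proof (induction p rule: rev_induct)
  case (snoc x p)
  then show ?case
    using assms(1)[of "last p" x] by (cases "p = []") (auto simp: successively_append_iff intro: le_SucI)
qed simp

lemma finite_paths:
  assumes step: "\<And>p q. step p q \<Longrightarrow> fst q + snd q = Suc (fst p + snd p)" and "finite B"
  shows "finite (paths step A B)"
proof -
  obtain S where S: "\<And>x. x \<in> B \<Longrightarrow> fst x + snd x \<le> S"
    using finite_imageI[OF \<open>finite B\<close>, of "\<lambda>x. fst x + snd x"]
    unfolding finite_nat_set_iff_bounded_le by blast
  have "paths step A B \<subseteq> {p. set p \<subseteq> {..S} \<times> {..S} \<and> length p \<le> Suc S}"
  proof
    fix p assume "p \<in> paths step A B"
    then have p: "p \<noteq> []" "successively step p" "fst (last p) + snd (last p) \<le> S"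
      using S by (auto simp: paths_def)
    note bounds = successively_bounds[of step p, OF step p(2,1)]
    have "x \<in> {..S} \<times> {..S}" if "x \<in> set p" for x
    proof -
      have "fst x + snd x \<le> S"
        using bounds p(3) that le_trans by blast
      then show ?thesis
        by (simp add: mem_Times_iff)
    qed
    then have "set p \<subseteq> {..S} \<times> {..S}"
      by blast
    moreover have "length p \<le> Suc S"
      using bounds p(3) by linarith
    ultimately show "p \<in> {p. set p \<subseteq> {..S} \<times> {..S} \<and> length p \<le> Suc S}"
      by simp
  qed
  moreover have "finite {p. set p \<subseteq> {..S} \<times> {..S} \<and> length p \<le> Suc S}"
    by (intro finite_lists_length_le) simp
  ultimately show ?thesis
    by (rule finite_subset)
qed

lemma up_right_sum: "up_right_step p q \<Longrightarrow> fst q + snd q = Suc (fst p + snd p)"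
  by (auto simp: up_right_step_def)

lemma down_right_sum: "down_right_step p q \<Longrightarrow> fst q + snd q = Suc (fst p + snd p)"
  by (auto simp: down_right_step_def)

lemma paths_snoc:
  "p \<in> paths step A {x} \<Longrightarrow> step x y \<Longrightarrow> p @ [y] \<in> paths step A {y}"
  by (auto simp: paths_def successively_append_iff)

lemma paths_single: "x \<in> A \<Longrightarrow> [x] \<in> paths step A {x}"
  by (simp add: paths_def)

lemma paths_induct [consumes 1, case_names single snoc]:
  assumes "p \<in> paths step A {x}"
    and "\<And>x. x \<in> A \<Longrightarrow> P [x] x"
    and "\<And>p x y. p \<in> paths step A {x} \<Longrightarrow> P p x \<Longrightarrow> step x y \<Longrightarrow> P (p @ [y]) y"
  shows "P p x"
  using assms(1)
proof (induction p arbitrary: x rule: rev_induct)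
  case (snoc y p)
  show ?case
  proof (cases "p = []")
    case True
    then have "x \<in> A" "y = x"
      using snoc.prems by (auto simp: paths_def)
    then show ?thesis
      using assms(2)[of x] True by simp
  next
    case False
    then have "p \<in> paths step A {last p}" "step (last p) y" "x = y"
      using snoc.prems by (auto simp: paths_def successively_append_iff)
    then show ?thesis
      using snoc.IH assms(3) by blast
  qed
qed (simp add: paths_def)

section \<open>Maximal weight of up-right paths\<close>

lemma up_right_path_le:
  "p \<in> paths up_right_step {(1, 1)} {x} \<Longrightarrow>
    1 \<le> fst x \<and> 1 \<le> snd x \<and> path_weight u p \<le> queue_departure u (fst x) (snd x)"
proof (induction p x rule: paths_induct)
  case (single x)
  then show ?case
    by (simp add: path_weight_def)
next
  case (snoc p x y)
  obtain a b where x: "x = (a, b)" "1 \<le> a" "1 \<le> b"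
    using snoc by (cases x) auto
  from snoc.hyps(2) show ?case
    using snoc.IH x by (cases a; cases b) (auto simp: up_right_step_def)
qed

text \<open>Trace the recursion back along the argument attaining the maximum. On the border a
  single predecessor lies on the grid, and the other argument is zero.\<close>

lemma up_right_path_ex:
  "1 \<le> n \<Longrightarrow> 1 \<le> j \<Longrightarrow>
    \<exists>p \<in> paths up_right_step {(1, 1)} {(n, j)}. path_weight u p = queue_departure u n j"
proof (induction u n j rule: queue_departure.induct)
  case (3 u n j)
  let ?P = "\<lambda>n j. paths up_right_step {(1, 1)} {(n, j)}"
  have zero: "queue_departure u k 0 = 0" for k
    by (cases k) auto
  have extend: "\<exists>p \<in> ?P (Suc n) (Suc j). path_weight u p = w + u (Suc n) (Suc j)"
    if "p \<in> ?P a b" "path_weight u p = w" "up_right_step (a, b) (Suc n, Suc j)" for p a b w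
    using paths_snoc[OF that(1,3)] that(2) by (intro bexI[of _ "p @ [(Suc n, Suc j)]"]) simp_all
  have right: "up_right_step (n, Suc j) (Suc n, Suc j)" and up: "up_right_step (Suc n, j) (Suc n, Suc j)"
    by (simp_all add: up_right_step_def)
  show ?case
  proof (cases "n = 0 \<and> j = 0")
    case True
    then show ?thesis
      by (intro bexI[of _ "[(1, 1)]"]) (simp_all add: path_weight_def paths_def)
  next
    case False
    show ?thesis
    proof (cases "1 \<le> n \<and> (j = 0 \<or> queue_departure u (Suc n) j \<le> queue_departure u n (Suc j))")
      case True
      then have "queue_departure u (Suc n) (Suc j) = queue_departure u n (Suc j) + u (Suc n) (Suc j)"
        by (auto simp: max_def)
      then show ?thesis
        using 3(1) True extend[of _ n "Suc j", OF _ _ right] by auto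
    next
      case nle: False
      then have "1 \<le> j"
        using False by auto
      moreover have "queue_departure u (Suc n) (Suc j) = queue_departure u (Suc n) j + u (Suc n) (Suc j)"
        using nle \<open>1 \<le> j\<close> by (cases n) (auto simp: max_def)
      ultimately show ?thesis
        using 3(2) extend[of _ "Suc n" j, OF _ _ up] by auto
    qed
  qed
qed auto

lemma max_path_weight_eq:
  assumes "K \<ge> 1" "N \<ge> 1"
  shows "max_path_weight N K u = queue_departure u N K"
  unfolding max_path_weight_def
proof (rule Max_eqI)
  show "finite (path_weight u ` Pi_paths N K)"
    unfolding Pi_paths_def by (intro finite_imageI finite_paths up_right_sum) auto
next
  fix w assume "w \<in> path_weight u ` Pi_paths N K"
  then show "w \<le> queue_departure u N K"
    using up_right_path_le[of _ "(N, K)" u] by (auto simp: Pi_paths_def)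
next
  show "queue_departure u N K \<in> path_weight u ` Pi_paths N K"
    using up_right_path_ex[OF assms(2,1), of u] by (force simp: Pi_paths_def)
qed

section \<open>Minimal weight of down-right paths\<close>

abbreviation tilde_starts :: "nat \<Rightarrow> (nat \<times> nat) set" where
  "tilde_starts K \<equiv> {(1 + i, K - i) |i. i \<le> K - 1}"

text \<open>The second argument of the minimum moves from \<open>(n + 1, j)\<close> to
  \<open>(n, j + 1)\<close> without cost. A path step \<open>(1 + i, - i)\<close>, read backwards,
  is one paid move in the first coordinate and then \<open>i\<close> such free moves.\<close>

lemma store_total_skip: "j + i \<le> K \<Longrightarrow> store_total K u (n + i) j \<le> store_total K u n (j + i)"
proof (induction i arbitrary: j)
  case (Suc i)
  have "store_total K u (n + Suc i) j \<le> store_total K u (n + i) (Suc j)"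
    using Suc.prems by simp
  also have "\<dots> \<le> store_total K u n (Suc j + i)"
    using Suc.prems by (intro Suc.IH) simp
  finally show ?case by simp
qed simp

text \<open>Goods need until slot \<open>K + 1 - j\<close> to reach store \<open>K + 1 - j\<close>.
  Hence the totals vanish just before the antidiagonal of starting points.\<close>

lemma store_total_eq_0: "n + j \<le> K \<Longrightarrow> store_total K u n j = 0"
  by (induction n arbitrary: j) auto

lemma store_total_Suc_le: "store_total K u (Suc n) j \<le> store_total K u n j + u (Suc n) j"
  by simp

text \<open>The weight bound unrolls the recursion along the path. The coordinate bounds keep free
  moves within \<open>K\<close> and later show that no path exists for \<open>N < K\<close>.\<close>

lemma down_right_path_ge:
  assumes "K \<ge> 1"
  shows "p \<in> paths down_right_step (tilde_starts K) {x} \<Longrightarrow>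
    K + 1 \<le> fst x + snd x \<and> snd x \<le> K \<and> store_total K u (fst x) (snd x) \<le> path_weight u p"
proof (induction p x rule: paths_induct)
  case (single x)
  then obtain i where i: "x = (Suc i, K - i)" "i \<le> K - 1"
    by auto
  then have "store_total K u i (K - i) = 0"
    by (intro store_total_eq_0) simp
  moreover have "fst x + snd x = K + 1" "snd x \<le> K"
    using i assms by simp_all
  ultimately show ?case
    using i(1) store_total_Suc_le[of K u i "K - i"] by (auto simp: path_weight_def)
next
  case (snoc p x y)
  obtain a b where y: "y = (a, b)"
    by (cases y)
  obtain i where "fst y = fst x + (1 + i)" "snd y + i = snd x"
    using snoc.hyps(2) unfolding down_right_step_def by blast
  then have i: "a = Suc (fst x + i)" "snd x = b + i"
    using y by simp_all
  have "store_total K u a b \<le> store_total K u (fst x + i) b + u a b"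
    using store_total_Suc_le i by simp
  also have "store_total K u (fst x + i) b \<le> store_total K u (fst x) (snd x)"
    using store_total_skip[of b i K u "fst x"] snoc.IH i by simp
  also have "\<dots> \<le> path_weight u p"
    using snoc.IH by simp
  finally show ?case
    using snoc.IH i y by simp
qed

text \<open>Tracing back from \<open>(n, j)\<close> may begin with free moves, which visit no point.
  So the path found ends anywhere up the antidiagonal; for \<open>j = 1\<close> this is the
  prescribed set of end points.\<close>

lemma down_right_path_ex:
  "1 \<le> j \<Longrightarrow> j \<le> K \<Longrightarrow> K < n + j \<Longrightarrow>
    \<exists>i p. i < n \<and> j + i \<le> K \<and> p \<in> paths down_right_step (tilde_starts K) {(n - i, j + i)}
      \<and> path_weight u p = store_total K u n j"
proof (induction n arbitrary: j)
  case (Suc n)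
  show ?case
  proof (cases "store_total K u (Suc n) j = store_total K u n j + u (Suc n) j")
    case True
    show ?thesis
    proof (cases "K < n + j")
      \<comment> \<open>Here \<open>Suc n + j = K + 1\<close>, so \<open>(Suc n, j)\<close> is
        itself a starting point and the earlier total is zero.\<close>
      case False
      then have "[(Suc n, j)] \<in> paths down_right_step (tilde_starts K) {(Suc n, j)}"
        using Suc.prems by (intro paths_single) auto
      moreover have "store_total K u n j = 0"
        using False by (intro store_total_eq_0) simp
      ultimately show ?thesis
        using True Suc.prems
        by (intro exI[of _ 0] exI[of _ "[(Suc n, j)]"]) (simp add: path_weight_def)
    next
      case less: True
      obtain i p where ip: "i < n" "p \<in> paths down_right_step (tilde_starts K) {(n - i, j + i)}"
        "path_weight u p = store_total K u n j"
        using Suc.IH[of j] Suc.prems less by auto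
      have "down_right_step (n - i, j + i) (Suc n, j)"
        using ip(1) by (auto simp: down_right_step_def intro!: exI[of _ i])
      from paths_snoc[OF ip(2) this] show ?thesis
        using True ip(3) Suc.prems
        by (intro exI[of _ 0] exI[of _ "p @ [(Suc n, j)]"]) simp
    qed
  next
    case False
    then have j: "j < K" "store_total K u (Suc n) j = store_total K u n (Suc j)"
      by (auto simp: min_def split: if_splits)
    obtain i p where "i < n" "Suc j + i \<le> K"
      "p \<in> paths down_right_step (tilde_starts K) {(n - i, Suc j + i)}"
      "path_weight u p = store_total K u n (Suc j)"
      using Suc.IH[of "Suc j"] Suc.prems j by auto
    \<comment> \<open>A free move leaves the path as it is; only its offset from
      \<open>(Suc n, j)\<close> grows by one.\<close>
    then show ?thesis
      using j by (intro exI[of _ "Suc i"] exI[of _ p]) simp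
  qed
qed simp

lemma paths_Union: "paths step A B = (\<Union>x\<in>B. paths step A {x})"
  by (auto simp: paths_def)

lemma min_path_weight_eq:
  assumes "K \<ge> 1" "N \<ge> 1"
  shows "min_path_weight N K u = store_total K u N 1"
proof (cases "N < K")
  case True
  have "Pi_tilde_paths N K = {}"
    unfolding Pi_tilde_paths_def using down_right_path_ge[OF assms(1)] assms(2) True
    by (subst paths_Union) fastforce
  then show ?thesis
    using True by (simp add: min_path_weight_def store_total_eq_0)
next
  case False
  obtain i p where ip: "i < N" "1 + i \<le> K"
    "p \<in> paths down_right_step (tilde_starts K) {(N - i, 1 + i)}"
    "path_weight u p = store_total K u N 1"
    using down_right_path_ex[of 1 K N u] assms False by auto
  have p: "p \<in> Pi_tilde_paths N K"
    unfolding Pi_tilde_paths_def using ip(1,3) by (subst paths_Union) (intro UN_I[of "(N - i, 1 + i)"], auto)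
  have "Min (path_weight u ` Pi_tilde_paths N K) = store_total K u N 1"
  proof (rule Min_eqI)
    show "finite (path_weight u ` Pi_tilde_paths N K)"
      unfolding Pi_tilde_paths_def by (intro finite_imageI finite_paths down_right_sum) auto
  next
    fix w assume "w \<in> path_weight u ` Pi_tilde_paths N K"
    then obtain j q where q: "w = path_weight u q" "j \<le> N - 1"
      "q \<in> paths down_right_step (tilde_starts K) {(N - j, 1 + j)}"
      unfolding Pi_tilde_paths_def by (subst (asm) paths_Union) auto
    then have "1 + j \<le> K" "store_total K u (N - j) (1 + j) \<le> w"
      using down_right_path_ge[OF assms(1) q(3), of u] by auto
    \<comment> \<open>Free moves lead from \<open>(N, 1)\<close> to whichever end point the path
      has.\<close>
    then show "store_total K u N 1 \<le> w"
      using store_total_skip[of 1 j K u "N - j"] q(2) assms(2) by simp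
  next
    show "store_total K u N 1 \<in> path_weight u ` Pi_tilde_paths N K"
      using p ip(4) by force
  qed
  then show ?thesis
    using p by (auto simp: min_path_weight_def)
qed

theorem theorem3:
  fixes N K :: nat and u :: "nat \<Rightarrow> nat \<Rightarrow> nat"
  assumes "K \<ge> 1" and "N \<ge> 1"
  shows "shape (rsk_tableau (matrix_word N K u)) 1 = max_path_weight N K u
       \<and> max_path_weight N K u = queue_departure u N K
       \<and> shape (rsk_tableau (matrix_word N K u)) K = min_path_weight N K u
       \<and> min_path_weight N K u = (\<Sum>n=1..N. store_departure K u K n)"
proof -
  \<comment> \<open>Slot 0 contributes nothing.\<close>
  have "(\<Sum>m\<le>N. store_departure K u K m) = (\<Sum>n=1..N. store_departure K u K n)"
    by (simp add: atMost_atLeast0 sum.atLeast_Suc_atMost)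
  then show ?thesis
    using sum_store_departure[of "K - 1" K u N] shape_first_row[of N K u]
      max_path_weight_eq[OF assms, of u] min_path_weight_eq[OF assms, of u]
      shape_last_row[OF assms(1), of N u] assms by simp
qed

end
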